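(* Let $a,b,c$ be real numbers such that none of $a,b,c$ is a negative integer, $c\neq 0$, and $c-a\notin\{0,-1,-2,\dots\}$, $c-b\notin\{0,-1,-2,\dots\}$. Suppose that one of the following conditions holds: (1) $0<ab<1$ and $a+b\le c<1+a+b-ab$; (2) $ab<0$ and $a+b\le c<1+a+b$. Then the order of convexity of the function $f(z)=z\,{}_2F_1(a,b;c;z)$ is $-\infty$, i.e. $\kappa(f)=-\infty$.
   Context: $\mathbb D=\{z\in\mathbb C:|z|<1\}$. For real $a,b,c$ with $c\ne 0,-1,-2,\dots$, the Gaussian hypergeometric function is ${}_2F_1(a,b;c;z)=\sum_{n=0}^\infty \frac{(a)_n(b)_n}{(c)_n n!}z^n$ for $z\in\mathbb D$, where $(a)_0=1$ and $(a)_n=a(a+1)\cdots(a+n-1)$. For $f$ analytic in $\mathbb D$ with $f(0)=0$, $f'(0)=1$, the order of convexity of $f$ is $\kappa(f)=1+\inf_{z\in\mathbb D}\operatorname{Re}\frac{zf''(z)}{f'(z)}\in[-\infty,1]$. Convention: $\kappa(f)=-\infty$ only if $f'$ has no zeros in $\mathbb D$ and $\operatorname{Re}[zf''(z)/f'(z)]$ is not bounded from below in $\mathbb D$; $\kappa(f)$ is regarded as not defined if $f'$ has zeros in $\mathbb D$.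
   Formalization: The formal theorem additionally assumes that κ(f) is defined, i.e. that f' has no zeros in the unit disc; without this the claim fails, e.g. for a=-1/2, b=2, c=3/2, where f' has a zero in (0,3/4). *)

theory Defs
  imports "HOL-Analysis.Analysis"
begin

text \<open>The parameters are real, the argument is complex. Outside the unit disc (where the series
  need not converge) the value is irrelevant.\<close>

definition hyp2F1 :: "real \<Rightarrow> real \<Rightarrow> real \<Rightarrow> complex \<Rightarrow> complex" where
  "hyp2F1 a b c z =
     eval_fps (fps_hypergeo [complex_of_real a, complex_of_real b] [complex_of_real c] 1) z"

lemma hyp2F1_series:
  "hyp2F1 a b c z =
     (\<Sum>n. complex_of_real (pochhammer a n * pochhammer b n / (pochhammer c n * fact n)) * z ^ n)"
  unfolding hyp2F1_def eval_fps_def fps_hypergeo_nth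
  by (simp flip: pochhammer_of_real)

text \<open>The value \<open>None\<close> encodes that the order of convexity is not defined; this is the case
  exactly when the derivative has a zero in the unit disc. In particular the value
  \<open>Some (- \<infinity>)\<close> means that the derivative has no zeros and that the real part is not bounded
  from below.\<close>

definition order_of_convexity :: "(complex \<Rightarrow> complex) \<Rightarrow> ereal option" where
  "order_of_convexity f =
     (if \<exists>z\<in>ball 0 1. deriv f z = 0 then None
      else Some (1 + (INF z\<in>ball 0 1. ereal (Re (z * deriv (deriv f) z / deriv f z)))))"

end

theory Submission
  imports Defs "HOL-Complex_Analysis.Complex_Analysis"
begin

text \<open>
  Write \<open>F\<close> for the Gauss series, \<open>G = f' = (z F)'\<close>, \<open>p = z G' / G\<close> and \<open>s = c - a - b\<close>, so that
  \<open>0 \<le> s < 1\<close> and \<open>s < 1 - a b\<close>. It has to be shown that \<open>Re p\<close> is unbounded below on the disc,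
  given that \<open>G\<close> has no zeros there.

  The singularity of \<open>G\<close> at \<open>1\<close> is of the type \<open>(1 - z) powr (s - 1)\<close>, so \<open>p(r)\<close> behaves like
  \<open>(1 - s) / (1 - r)\<close> and tends to plus infinity along the positive radius. Near \<open>1\<close>, the real
  part of \<open>p\<close> gets very negative only in directions tangential to the unit circle. It is nevertheless
  enough to look at the positive radius. If \<open>Re p\<close> were bounded below by \<open>- M\<close>, then \<open>p + M\<close> would map
  the disc to a half-plane, and Harnack's inequality would make \<open>(1 - r) / (1 + r) * (p(r) + M)\<close>
  decreasing in \<open>r\<close>, with limit \<open>(1 - s) / 2\<close>. Hence \<open>p(r) - (1 - s) / (1 - r)\<close> would be bounded below
  (\<open>radial_lower_bound\<close>). The second term of the expansion of \<open>p\<close> contradicts this.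

  For that second term, the hypergeometric equation gives the exact identity
  \<open>p(r) = (1 - s) / (1 - r) + (1 - a - b) + \<phi>(r) F(r) / ((1 - r) G(r))\<close> with an affine function \<open>\<phi>\<close>
  such that \<open>\<phi>(1) = - (1 - s - a b) < 0\<close> (\<open>Gauss_fps_convexity_identity\<close>). So it remains to see that
  \<open>F(r) / ((1 - r) G(r))\<close> tends to plus infinity. On \<open>[0, 1)\<close> the zero-free function \<open>G\<close> is positive
  because \<open>G(0) = 1\<close>, hence \<open>r F(r)\<close>, the integral of \<open>G\<close>, is positive as well. By Euler's
  transformation, \<open>F(r) = (1 - r) powr s * E(r)\<close>, where \<open>E\<close> is the Gauss series with parameters
  \<open>c - a, c - b; c\<close>, so the quotient equals \<open>E(r) / ((1 - r) powr (1 - s) * G(r))\<close>. The denominator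
  has a finite positive limit by an Abelian theorem (\<open>abelian_power\<close>). The coefficients of \<open>E\<close> are
  asymptotic to a nonzero multiple of \<open>n powr (s - 1)\<close>, because neither \<open>c - a\<close> nor \<open>c - b\<close> is a
  nonpositive integer; they are not summable, and the positive function \<open>E\<close> tends to plus infinity
  (\<open>Gauss_fps_at_top\<close>). This treats \<open>s = 0\<close>, where \<open>F\<close> is logarithmically large at \<open>1\<close>, together
  with \<open>s > 0\<close>, where \<open>F\<close> has a finite limit.
\<close>

section \<open>Power series on the unit disc and their growth at 1\<close>

lemma eval_fps_mult_unit:
  fixes A B :: "'a :: {banach, real_normed_field} fps"
  assumes "fps_conv_radius A \<ge> 1" "fps_conv_radius B \<ge> 1" "norm z < 1"
  shows "eval_fps (A * B) z = eval_fps A z * eval_fps B z"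
proof (rule eval_fps_mult)
  have "ereal (norm z) < 1" using assms by simp
  thus "ereal (norm z) < fps_conv_radius A" "ereal (norm z) < fps_conv_radius B"
    using assms by (blast intro: less_le_trans)+
qed

lemma eval_fps_add_unit:
  fixes A B :: "'a :: {banach, real_normed_field} fps"
  assumes "fps_conv_radius A \<ge> 1" "fps_conv_radius B \<ge> 1" "norm z < 1"
  shows "eval_fps (A + B) z = eval_fps A z + eval_fps B z"
proof (rule eval_fps_add)
  have "ereal (norm z) < 1" using assms by simp
  thus "ereal (norm z) < fps_conv_radius A" "ereal (norm z) < fps_conv_radius B"
    using assms by (blast intro: less_le_trans)+
qed

lemma eval_fps_diff_unit:
  fixes A B :: "'a :: {banach, real_normed_field} fps"
  assumes "fps_conv_radius A \<ge> 1" "fps_conv_radius B \<ge> 1" "norm z < 1"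
  shows "eval_fps (A - B) z = eval_fps A z - eval_fps B z"
proof (rule eval_fps_diff)
  have "ereal (norm z) < 1" using assms by simp
  thus "ereal (norm z) < fps_conv_radius A" "ereal (norm z) < fps_conv_radius B"
    using assms by (blast intro: less_le_trans)+
qed

lemma fps_conv_radius_unit:
  fixes A B :: "'a :: {banach, real_normed_field} fps"
  assumes "fps_conv_radius A \<ge> 1" "fps_conv_radius B \<ge> 1"
  shows "fps_conv_radius (A * B) \<ge> 1" "fps_conv_radius (A + B) \<ge> 1" "fps_conv_radius (A - B) \<ge> 1"
  using assms fps_conv_radius_mult[of A B] fps_conv_radius_add[of A B] fps_conv_radius_diff[of A B]
  by (meson min.boundedI order_trans)+


lemma fps_conv_radius_deriv_unit:
  fixes A :: "'a :: {banach, real_normed_field} fps"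
  assumes "fps_conv_radius A \<ge> 1"
  shows "fps_conv_radius (fps_deriv A) \<ge> 1"
  using assms fps_conv_radius_deriv order_trans by blast

lemma summable_fps_real:
  fixes A :: "real fps"
  assumes "fps_conv_radius A \<ge> 1" "0 \<le> r" "r < 1"
  shows "summable (\<lambda>n. fps_nth A n * r ^ n)"
proof (rule summable_fps)
  have "ereal (norm r) < 1" using assms by simp
  thus "ereal (norm r) < fps_conv_radius A" using assms(1) by (rule less_le_trans)
qed

text \<open>
  The terms before the index from which the coefficients are dominated contribute at most a constant,
  uniformly for \<open>r\<close> in \<open>[0, 1)\<close>.
\<close>

lemma eval_fps_dominated:
  fixes D B :: "real fps"
  assumes D: "fps_conv_radius D \<ge> 1" and B: "fps_conv_radius B \<ge> 1"
    and dom: "eventually (\<lambda>n. \<bar>fps_nth D n\<bar> \<le> e * fps_nth B n) sequentially"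
  obtains C where "\<And>r. 0 \<le> r \<Longrightarrow> r < 1 \<Longrightarrow> \<bar>eval_fps D r\<bar> \<le> C + e * eval_fps B r"
proof -
  obtain N where N: "\<And>n. n \<ge> N \<Longrightarrow> \<bar>fps_nth D n\<bar> \<le> e * fps_nth B n"
    using dom unfolding eventually_sequentially by blast
  \<comment> \<open>Termwise majorant of the defect: it is supported on the finitely many exceptional indices.\<close>
  define w where "w n = (if n \<in> {..<N} then \<bar>fps_nth D n\<bar> + \<bar>e * fps_nth B n\<bar> else 0)" for n
  have w: "w sums (\<Sum>n<N. \<bar>fps_nth D n\<bar> + \<bar>e * fps_nth B n\<bar>)"
    unfolding w_def by (rule sums_If_finite_set) simp
  show ?thesis
  proof (rule that)
    fix r :: real assume r: "0 \<le> r" "r < 1"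
    note sD = summable_fps_real[OF D r] and sB = summable_fps_real[OF B r]
    have bound: "\<bar>fps_nth D n * r ^ n\<bar> \<le> w n + e * (fps_nth B n * r ^ n)" for n
    proof -
      have *: "0 \<le> r ^ n" "r ^ n \<le> 1" using r by (auto intro: power_le_one)
      show ?thesis
      proof (cases "n < N")
        case True
        have "\<bar>fps_nth D n\<bar> * r ^ n \<le> \<bar>fps_nth D n\<bar> * 1" "\<bar>e * fps_nth B n\<bar> * r ^ n \<le> \<bar>e * fps_nth B n\<bar> * 1"
          using * by (intro mult_left_mono; simp)+
        moreover have "- (\<bar>e * fps_nth B n\<bar> * r ^ n) \<le> e * (fps_nth B n * r ^ n)"
          using * by (metis abs_ge_minus_self abs_mult abs_of_nonneg minus_le_iff mult.assoc)
        ultimately show ?thesis using True *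
          by (simp add: w_def abs_mult)
      next
        case False
        hence "\<bar>fps_nth D n\<bar> * r ^ n \<le> (e * fps_nth B n) * r ^ n" 
          using N * by (intro mult_right_mono) auto
        thus ?thesis using False * by (simp add: w_def abs_mult mult_ac)
      qed
    qed
    have sum': "(\<lambda>n. w n + e * (fps_nth B n * r ^ n)) sums
        ((\<Sum>n<N. \<bar>fps_nth D n\<bar> + \<bar>e * fps_nth B n\<bar>) + e * eval_fps B r)"
      unfolding eval_fps_def by (intro sums_add w sums_mult summable_sums sB)
    have sabs: "summable (\<lambda>n. \<bar>fps_nth D n * r ^ n\<bar>)"
      by (rule summable_comparison_test'[OF sums_summable[OF sum'], of 0]) (use bound in auto)
    have "\<bar>eval_fps D r\<bar> \<le> (\<Sum>n. \<bar>fps_nth D n * r ^ n\<bar>)"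
      unfolding eval_fps_def by (rule summable_rabs[OF sabs])
    also have "\<dots> \<le> (\<Sum>n. w n + e * (fps_nth B n * r ^ n))"
      by (rule suminf_le[OF bound sabs sums_summable[OF sum']])
    also have "\<dots> = (\<Sum>n<N. \<bar>fps_nth D n\<bar> + \<bar>e * fps_nth B n\<bar>) + e * eval_fps B r"
      using sum' by (simp add: sums_iff)
    finally show "\<bar>eval_fps D r\<bar> \<le> \<dots>" .
  qed
qed

text \<open>
  Abelian theorem: the coefficients of \<open>A - L B\<close> are eventually at most \<open>e / 2\<close> times those of \<open>B\<close>, so
  \<open>\<bar>A(r) - L B(r)\<bar> \<le> C + e / 2 * B(r)\<close>, and the constant disappears upon division by the unbounded
  \<open>B(r)\<close>.
\<close>

lemma abelian_ratio:
  fixes A B :: "real fps"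
  assumes A: "fps_conv_radius A \<ge> 1" and B: "fps_conv_radius B \<ge> 1"
    and pos: "eventually (\<lambda>n. fps_nth B n > 0) sequentially"
    and lim: "(\<lambda>n. fps_nth A n / fps_nth B n) \<longlonglongrightarrow> L"
    and inf: "filterlim (eval_fps B) at_top (at_left 1)"
  shows "((\<lambda>r. eval_fps A r / eval_fps B r) \<longlongrightarrow> L) (at_left 1)"
proof (rule tendstoI)
  fix e :: real assume e: "e > 0"
  define D where "D = A - fps_const L * B"
  have LB: "fps_conv_radius (fps_const L * B) \<ge> 1"
    by (rule fps_conv_radius_unit) (use B in simp_all)
  have D: "fps_conv_radius D \<ge> 1" unfolding D_def by (rule fps_conv_radius_unit[OF A LB])
  have "eventually (\<lambda>n. \<bar>fps_nth D n\<bar> \<le> e / 2 * fps_nth B n) sequentially"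
    using pos tendstoD[OF lim half_gt_zero[OF e]] unfolding D_def
  proof eventually_elim
    case (elim n)
    have "\<bar>fps_nth A n / fps_nth B n - L\<bar> * fps_nth B n \<le> e / 2 * fps_nth B n"
      using elim by (intro mult_right_mono) (auto simp: dist_real_def)
    moreover have "\<bar>fps_nth A n / fps_nth B n - L\<bar> * fps_nth B n = \<bar>(fps_nth A n / fps_nth B n - L) * fps_nth B n\<bar>"
      using elim by (simp add: abs_mult)
    moreover have "(fps_nth A n / fps_nth B n - L) * fps_nth B n = fps_nth A n - L * fps_nth B n"
      using elim by (simp add: field_simps)
    ultimately show ?case by simp
  qed
  from eval_fps_dominated[OF D B this] obtain C where
    C: "\<And>r. 0 \<le> r \<Longrightarrow> r < 1 \<Longrightarrow> \<bar>eval_fps D r\<bar> \<le> C + e / 2 * eval_fps B r" by blast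
  have "eventually (\<lambda>r::real. r \<in> {0<..<1}) (at_left 1)"
    by (rule eventually_at_left_real) simp
  moreover have "eventually (\<lambda>r. eval_fps B r \<ge> max 1 (2 * (C + 1) / e)) (at_left 1)"
    using inf unfolding filterlim_at_top by blast
  ultimately show "eventually (\<lambda>r. dist (eval_fps A r / eval_fps B r) L < e) (at_left 1)"
  proof eventually_elim
    case (elim r)
    have r: "0 \<le> r" "r < 1" using elim by auto
    have D': "eval_fps D r = eval_fps A r - L * eval_fps B r"
      unfolding D_def using r by (simp add: eval_fps_diff_unit eval_fps_mult_unit A B LB)
    have B1: "eval_fps B r \<ge> 1" "2 * (C + 1) / e \<le> eval_fps B r" using elim by auto
    have "C + 1 \<le> e / 2 * eval_fps B r" using B1 e by (simp add: field_simps)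
    hence "\<bar>eval_fps D r\<bar> < e * eval_fps B r" using C[OF r] by (simp add: field_simps)
    moreover have "eval_fps A r / eval_fps B r - L = eval_fps D r / eval_fps B r"
      using B1 by (simp add: D' field_simps)
    ultimately show ?case using B1 by (simp add: dist_real_def abs_divide field_simps)
  qed
qed

text \<open>
  Some partial sum at \<open>1\<close> exceeds any given bound; as a polynomial it still does so for \<open>r\<close> near \<open>1\<close>,
  and the tail that is cut off is nonnegative.
\<close>

lemma eval_fps_at_top:
  fixes B :: "real fps"
  assumes B: "fps_conv_radius B \<ge> 1"
    and nonneg: "eventually (\<lambda>n. fps_nth B n \<ge> 0) sequentially"
    and div: "\<not> summable (fps_nth B)"
  shows "filterlim (eval_fps B) at_top (at_left 1)"
  unfolding filterlim_at_top
proof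
  fix M :: real
  obtain N where N: "\<And>n. n \<ge> N \<Longrightarrow> fps_nth B n \<ge> 0"
    using nonneg unfolding eventually_sequentially by blast
  obtain m where m: "m \<ge> N" "(\<Sum>n<m. fps_nth B n) > M"
  proof -
    have "\<exists>m. (\<Sum>n<m. fps_nth B (n + N)) > M - (\<Sum>n<N. fps_nth B n)"
    proof (rule ccontr)
      assume "\<not> ?thesis"
      hence "summable (\<lambda>n. fps_nth B (n + N))"
        by (intro summableI_nonneg_bounded) (auto intro: N simp: not_less)
      thus False using div by (simp add: summable_iff_shift)
    qed
    then obtain m where "(\<Sum>n<m. fps_nth B (n + N)) > M - (\<Sum>n<N. fps_nth B n)" by blast
    moreover have "(\<Sum>n<m + N. fps_nth B n) = (\<Sum>n<N. fps_nth B n) + (\<Sum>n<m. fps_nth B (n + N))"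
      by (induction m) auto
    ultimately show ?thesis by (intro that[of "m + N"]) auto
  qed
  have "((\<lambda>r. \<Sum>n<m. fps_nth B n * r ^ n) \<longlongrightarrow> (\<Sum>n<m. fps_nth B n * 1 ^ n)) (at_left 1)"
    by (intro tendsto_intros)
  hence "eventually (\<lambda>r. (\<Sum>n<m. fps_nth B n * r ^ n) > M) (at_left 1)"
    by (rule order_tendstoD) (use m in simp)
  moreover have "eventually (\<lambda>r::real. r \<in> {0<..<1}) (at_left 1)"
    by (rule eventually_at_left_real) simp
  ultimately show "eventually (\<lambda>r. M \<le> eval_fps B r) (at_left 1)"
  proof eventually_elim
    case (elim r)
    have "(\<Sum>n<m. fps_nth B n * r ^ n) \<le> eval_fps B r" unfolding eval_fps_def
      by (rule sum_le_suminf) (use elim m in \<open>auto intro!: summable_fps_real B mult_nonneg_nonneg N\<close>)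
    thus ?case using elim by simp
  qed
qed

section \<open>A lower bound along a radius\<close>

text \<open>
  Harnack's inequality as a monotonicity statement. A disc automorphism moves \<open>r\<close> to the origin, and
  \<open>w \<mapsto> (w - p(r)) / (w + p(r))\<close> maps the right half-plane to the disc and \<open>p(r)\<close> to \<open>0\<close>. The Schwarz
  lemma, applied to the composition at the preimage \<open>t\<close> of \<open>q\<close>, is the assertion.
\<close>

lemma harnack_radial:
  fixes P :: "complex \<Rightarrow> complex"
  assumes hol: "P holomorphic_on ball 0 1"
    and pos: "\<And>z. norm z < 1 \<Longrightarrow> Re (P z) > 0"
    and real: "\<And>r. 0 \<le> r \<Longrightarrow> r < 1 \<Longrightarrow> P (of_real r) = of_real (p r)"
    and r: "0 \<le> r" "r \<le> q" "q < 1"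
  shows "(1 - q) / (1 + q) * p q \<le> (1 - r) / (1 + r) * p r"
proof -
  define T where "T w = Moebius_function 0 (- of_real r) w" for w
  define Q where "Q w = (P (T w) - of_real (p r)) / (P (T w) + of_real (p r))" for w
  have nr: "norm (- complex_of_real r) < 1" using r by simp
  have Tb: "norm (T w) < 1" if "norm w < 1" for w
    unfolding T_def by (rule Moebius_function_norm_lt_1[OF nr that])
  have Th: "T holomorphic_on ball 0 1"
    unfolding T_def[abs_def] by (rule Moebius_function_holomorphic[OF nr])
  have Te: "T w = (w + of_real r) / (1 + of_real r * w)" for w
    unfolding T_def by (simp add: Moebius_function_def)
  have u: "p r > 0" "p q > 0" using pos[of "of_real r"] pos[of "of_real q"] real[of r] real[of q] r by auto
  have nz: "P (T w) + of_real (p r) \<noteq> 0" if "norm w < 1" for w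
    using pos[OF Tb[OF that]] u by (auto simp: complex_eq_iff)
  have Qh: "Q holomorphic_on ball 0 1"
    unfolding Q_def
    by (intro holomorphic_intros holomorphic_on_compose_gen[OF Th hol, unfolded o_def])
       (use Tb nz in auto)
  have Q0: "Q 0 = 0" using real[of r] r by (simp add: Q_def Te)
  have Q1: "norm (Q w) < 1" if w: "norm w < 1" for w
  proof -
    have "norm (P (T w) - of_real (p r)) < norm (P (T w) + of_real (p r))"
    proof -
      have "0 < Re (P (T w)) * p r" using pos[OF Tb[OF w]] u by simp
      hence "(norm (P (T w) - of_real (p r)))\<^sup>2 < (norm (P (T w) + of_real (p r)))\<^sup>2"
        unfolding cmod_power2 by (simp add: power2_eq_square algebra_simps)
      thus ?thesis by (rule power_less_imp_less_base) simp
    qed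
    thus ?thesis using nz[OF w] by (simp add: Q_def norm_divide)
  qed
  define t where "t = (q - r) / (1 - r * q)"
  have rq: "r * q < 1" using r by (smt (verit) mult_left_le mult_nonneg_nonneg)
  have t: "0 \<le> t" "t < 1"
  proof -
    have "q - r < 1 - r * q" using mult_pos_pos[of "1-q" "1+r"] r
      by (simp add: algebra_simps)
    thus "0 \<le> t" "t < 1" using r rq by (auto simp: t_def)
  qed
  have Tt: "T (of_real t) = of_real q"
  proof -
    have "t * (1 - r * q) = q - r" using rq by (simp add: t_def)
    hence "(t + r) * (1 - r * q) = (q * (1 + r * t)) * (1 - r * q)" by algebra
    hence "t + r = q * (1 + r * t)" using rq by (metis less_irrefl mult_right_cancel right_minus_eq)
    moreover have "1 + r * t > 0" using r t by (simp add: add_pos_nonneg)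
    ultimately have "(t + r) / (1 + r * t) = q" by (simp add: field_simps)
    hence "complex_of_real ((t + r) / (1 + r * t)) = of_real q" by simp
    thus ?thesis by (simp add: Te)
  qed
  have "norm (Q (of_real t)) \<le> norm (complex_of_real t)"
    by (rule Schwarz_Lemma(1)[OF Qh Q0 Q1]) (use t in auto)
  moreover have "Q (of_real t) = of_real ((p q - p r) / (p q + p r))"
    unfolding Q_def Tt using real[of q] r by simp
  ultimately have "\<bar>(p q - p r) / (p q + p r)\<bar> \<le> t"
    using t by (metis abs_of_nonneg norm_of_real)
  hence "(p q - p r) / (p q + p r) \<le> t" by linarith
  hence "(p q - p r) * (1 - r * q) \<le> (q - r) * (p q + p r)"
    using u rq by (simp add: t_def field_simps)
  hence "(1 - q) * p q * (1 + r) \<le> (1 - r) * p r * (1 + q)"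
    by (simp add: algebra_simps)
  thus ?thesis using r by (simp add: field_simps)
qed

text \<open>
  The limit for \<open>q \<longlongrightarrow> 1\<close> in \<open>harnack_radial\<close>, rewritten with
  \<open>(1 + r) / (2 (1 - r)) = 1 / (1 - r) - 1 / 2\<close>. In the Herglotz representation of \<open>P + M\<close>, the number
  \<open>m / 2\<close> is the mass of the representing measure at the boundary point \<open>1\<close>: a function with real part
  bounded below cannot fall short of its pole-like leading term \<open>m / (1 - r)\<close> by an unbounded amount.
\<close>

lemma radial_lower_bound:
  fixes P :: "complex \<Rightarrow> complex"
  assumes hol: "P holomorphic_on ball 0 1"
    and bound: "\<And>z. norm z < 1 \<Longrightarrow> Re (P z) \<ge> - M"
    and real: "\<And>r. 0 \<le> r \<Longrightarrow> r < 1 \<Longrightarrow> P (of_real r) = of_real (p r)"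
    and lim: "((\<lambda>r. (1 - r) * p r) \<longlongrightarrow> m) (at_left 1)"
    and r: "0 \<le> r" "r < 1"
  shows "p r \<ge> m / (1 - r) - m / 2 - M - 1"
proof -
  have "((\<lambda>q. ((1 - q) * p q + (1 - q) * (M + 1)) / (1 + q)) \<longlongrightarrow> (m + (1 - 1) * (M + 1)) / (1 + 1)) (at_left 1)"
    by (intro tendsto_intros lim) auto
  hence lim': "((\<lambda>q. (1 - q) / (1 + q) * (p q + M + 1)) \<longlongrightarrow> m / 2) (at_left 1)"
    by (simp add: algebra_simps)
  have ev: "eventually (\<lambda>q::real. q \<in> {r<..<1}) (at_left 1)"
    by (rule eventually_at_left_real) (use r in simp)
  \<comment> \<open>Adding \<open>M + 1\<close> instead of \<open>M\<close> makes the real part strictly positive.\<close>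
  have "m / 2 \<le> (1 - r) / (1 + r) * (p r + M + 1)"
  proof (rule tendsto_upperbound[OF lim'])
    show "eventually (\<lambda>q. (1 - q) / (1 + q) * (p q + M + 1) \<le> (1 - r) / (1 + r) * (p r + M + 1)) (at_left 1)"
      using ev
    proof eventually_elim
      case (elim q)
      show ?case
      proof (rule harnack_radial[where P = "\<lambda>z. P z + of_real (M + 1)"])
        show "0 < Re (P z + of_real (M + 1))" if "norm z < 1" for z using bound[OF that] by simp
        show "P (of_real r) + of_real (M + 1) = of_real (p r + M + 1)" if "0 \<le> r" "r < 1" for r
          using real[OF that] by simp
      qed (use r elim in \<open>auto intro!: holomorphic_intros hol\<close>)
    qed
  qed simp
  hence "m / 2 * ((1 + r) / (1 - r)) \<le> p r + M + 1"
    using r by (simp add: field_simps)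
  moreover have "m / 2 * ((1 + r) / (1 - r)) = m / (1 - r) - m / 2"
    using r by (simp add: field_simps)
  ultimately show ?thesis by simp
qed

section \<open>Coefficients of the Gauss series\<close>

abbreviation Gauss_fps :: "'a \<Rightarrow> 'a \<Rightarrow> 'a \<Rightarrow> 'a :: field_char_0 fps" where
  "Gauss_fps a b c \<equiv> fps_hypergeo [a, b] [c] 1"

lemma Gauss_fps_nth:
  "fps_nth (Gauss_fps a b c) n = pochhammer a n * pochhammer b n / (pochhammer c n * fact n)"
  by simp

lemma pochhammer_ne_0:
  fixes c :: "'a :: field_char_0"
  assumes "c \<notin> \<int>\<^sub>\<le>\<^sub>0"
  shows "pochhammer c n \<noteq> 0"
  using assms by (auto simp: pochhammer_eq_0_iff)

lemma of_nat_add_ne_0: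
  fixes x :: "'a :: field_char_0"
  assumes "x \<notin> \<int>\<^sub>\<le>\<^sub>0"
  shows "x + of_nat n \<noteq> 0"
  using assms by (metis add_eq_0_iff minus_of_nat_in_nonpos_Ints add.commute)

lemma Gauss_fps_Suc:
  fixes a b c :: "'a :: field_char_0"
  shows "fps_nth (Gauss_fps a b c) (Suc n) =
     (a + of_nat n) * (b + of_nat n) / ((c + of_nat n) * (1 + of_nat n)) * fps_nth (Gauss_fps a b c) n"
  by (subst fps_hypergeo_rec) (simp add: mult.commute)

lemma Gauss_fps_rec:
  assumes "c \<notin> \<int>\<^sub>\<le>\<^sub>0"
  shows "(c + real n) * (real n + 1) * fps_nth (Gauss_fps a b c) (Suc n) =
           (a + real n) * (b + real n) * fps_nth (Gauss_fps a b c) n"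
proof -
  have "c + real n \<noteq> 0" "1 + real n \<noteq> 0" using of_nat_add_ne_0[OF assms] by (auto simp: add_eq_0_iff)
  thus ?thesis unfolding Gauss_fps_Suc by (simp add: add.commute[of 1])
qed

lemma Gauss_fps_conv_radius:
  fixes a b c :: "'a :: {real_normed_field, banach}"
  assumes "c \<notin> \<int>\<^sub>\<le>\<^sub>0" "a \<notin> \<int>\<^sub>\<le>\<^sub>0" "b \<notin> \<int>\<^sub>\<le>\<^sub>0"
  shows "fps_conv_radius (Gauss_fps a b c) = 1"
proof -
  let ?A = "fps_nth (Gauss_fps a b c)"
  have nz: "?A n \<noteq> 0" for n using assms by (simp add: pochhammer_ne_0)
  have lim1: "(\<lambda>n. 1 + x / of_nat n) \<longlonglongrightarrow> 1" for x :: 'a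
  proof -
    have "(\<lambda>n. x / of_nat n) \<longlonglongrightarrow> 0" by (rule lim_const_over_n)
    from tendsto_add[OF tendsto_const[of 1] this] show ?thesis by simp
  qed
  have "(\<lambda>n. norm (((1 + c / of_nat n) * (1 + 1 / of_nat n)) / ((1 + a / of_nat n) * (1 + b / of_nat n)))) \<longlonglongrightarrow> norm (((1::'a) * 1) / (1 * 1))"
    by (intro tendsto_intros lim1) auto
  moreover have "eventually (\<lambda>n. norm (((1 + c / of_nat n) * (1 + 1 / of_nat n)) / ((1 + a / of_nat n) * (1 + b / of_nat n))) =
      norm (?A n) / norm (?A (Suc n))) sequentially"
    using eventually_gt_at_top[of 0]
  proof eventually_elim
    case (elim n)
    have *: "1 + x / of_nat n = (x + of_nat n) / of_nat n" for x :: 'a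
      using elim by (simp add: field_simps)
    have "(((1 + c / of_nat n) * (1 + 1 / of_nat n)) / ((1 + a / of_nat n) * (1 + b / of_nat n))) =
            ((c + of_nat n) * (1 + of_nat n)) / ((a + of_nat n) * (b + of_nat n))"
      unfolding * using elim by simp
    also have "\<dots> = ?A n / ?A (Suc n)"
      unfolding Gauss_fps_Suc using nz[of n] by (simp add: add.commute del: fps_hypergeo_nth)
    finally show ?case by (simp only: norm_divide)
  qed
  ultimately have "(\<lambda>n. norm (?A n) / norm (?A (Suc n))) \<longlonglongrightarrow> 1"
    by (simp add: filterlim_cong[OF refl refl] tendsto_cong)
  thus ?thesis unfolding fps_conv_radius_def
    using conv_radius_ratio_limit_nonzero[where f = ?A and c = 1 and c' = 1] nz by (simp add: one_ereal_def del: fps_hypergeo_nth)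
qed

text \<open>
  Euler's limit formula for the Gamma function.
\<close>

lemma pochhammer_asymp:
  assumes "x \<notin> \<int>\<^sub>\<le>\<^sub>0"
  shows "(\<lambda>n. pochhammer x n / fact n * real n powr (1 - x)) \<longlonglongrightarrow> 1 / Gamma x"
proof -
  have "(\<lambda>n. inverse (Gamma_series' x n)) \<longlonglongrightarrow> inverse (Gamma x)"
    using assms by (intro tendsto_inverse Gamma_series'_LIMSEQ) (auto simp: Gamma_eq_zero_iff)
  moreover have "eventually (\<lambda>n. inverse (Gamma_series' x n) = pochhammer x n / fact n * real n powr (1 - x)) sequentially"
    using eventually_gt_at_top[of 0]
  proof eventually_elim
    case (elim n)
    have "exp (x * ln (real n)) = real n powr x" using elim by (simp add: powr_def)
    moreover have "real n powr (1 - x) = real n / real n powr x" using elim by (simp add: powr_diff)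
    moreover have "(fact n :: real) = real n * fact (n - 1)" using elim by (simp add: fact_num_eq_if)
    ultimately show ?case unfolding Gamma_series'_def using elim by simp
  qed
  ultimately show ?thesis by (simp add: tendsto_cong inverse_eq_divide)
qed

lemma Gauss_fps_asymp:
  assumes "a \<notin> \<int>\<^sub>\<le>\<^sub>0" "b \<notin> \<int>\<^sub>\<le>\<^sub>0" "c \<notin> \<int>\<^sub>\<le>\<^sub>0"
  shows "(\<lambda>n. fps_nth (Gauss_fps a b c) n * real n powr (1 + c - a - b)) \<longlonglongrightarrow>
           Gamma c / (Gamma a * Gamma b)"
proof -
  have "(\<lambda>n. (pochhammer a n / fact n * real n powr (1 - a)) * (pochhammer b n / fact n * real n powr (1 - b)) /
      (pochhammer c n / fact n * real n powr (1 - c))) \<longlonglongrightarrow> (1 / Gamma a) * (1 / Gamma b) / (1 / Gamma c)"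
    using assms by (intro tendsto_intros pochhammer_asymp) (auto simp: Gamma_eq_zero_iff)
  moreover have "eventually (\<lambda>n. (pochhammer a n / fact n * real n powr (1 - a)) * (pochhammer b n / fact n * real n powr (1 - b)) /
      (pochhammer c n / fact n * real n powr (1 - c)) = 
      fps_nth (Gauss_fps a b c) n * real n powr (1 + c - a - b)) sequentially"
    using eventually_gt_at_top[of 0]
  proof eventually_elim
    case (elim n)
    have "real n powr (1 - a) * real n powr (1 - b) = real n powr (1 + c - a - b) * real n powr (1 - c)"
      by (simp flip: powr_add add: algebra_simps)
    moreover have "real n powr (1 - c) \<noteq> 0" using elim by simp
    ultimately have *: "real n powr (1 + c - a - b) = real n powr (1 - a) * real n powr (1 - b) / real n powr (1 - c)"
      by simp
    have gen: "f \<noteq> 0 \<Longrightarrow> (x / f * u) * (y / f * v) / (z / f * w) = x * y / (z * f) * (u * v / w)"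
      for f x y z u v w :: real by (simp add: mult_ac)
    show ?case unfolding Gauss_fps_nth * by (rule gen) simp
  qed
  ultimately show ?thesis by (simp add: tendsto_cong mult.commute)
qed

section \<open>The binomial series and power-law growth\<close>

text \<open>
  The expansion of \<open>(1 - x) powr (- t)\<close>.
\<close>

abbreviation binom_fps :: "real \<Rightarrow> real fps" where
  "binom_fps t \<equiv> Abs_fps (\<lambda>n. pochhammer t n / fact n)"

lemma binom_fps_sums:
  assumes "\<bar>r\<bar> < 1"
  shows "(\<lambda>n. fps_nth (binom_fps t) n * r ^ n) sums (1 - r) powr (- t)"
proof -
  have "(\<lambda>n. ((-t) gchoose n) * (-r)^n) sums (1 + (-r)) powr (-t)"
    by (rule gen_binomial_real) (use assms in simp)
  moreover have "((-t) gchoose n) * (-r)^n = fps_nth (binom_fps t) n * r ^ n" for n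
  proof -
    have "(- r) ^ n = (- 1) ^ n * r ^ n" by (rule power_minus)
    moreover have "(- 1) ^ n * (- 1) ^ n = (1 :: real)" by (simp flip: power_mult_distrib)
    ultimately show ?thesis by (simp add: gbinomial_pochhammer)
  qed
  ultimately show ?thesis by simp
qed

lemma binom_fps_conv_radius: "fps_conv_radius (binom_fps t) \<ge> 1"
  unfolding fps_conv_radius_def
proof (rule conv_radius_geI_ex)
  fix r :: real assume "0 < r" "ereal r < 1"
  thus "\<exists>z::real. norm z = r \<and> summable (\<lambda>n. fps_nth (binom_fps t) n * z ^ n)"
    using sums_summable[OF binom_fps_sums[of r t]] by (intro exI[of _ r]) auto
qed

lemma eval_binom_fps: "\<bar>r\<bar> < 1 \<Longrightarrow> eval_fps (binom_fps t) r = (1 - r) powr (- t)"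
  unfolding eval_fps_def using binom_fps_sums[of r t] by (simp add: sums_iff)

text \<open>
  \<open>abelian_ratio\<close> with the binomial series as the series of comparison: its coefficients are
  asymptotic to \<open>n powr (t - 1) / Gamma t\<close>.
\<close>

lemma abelian_power:
  fixes A :: "real fps"
  assumes A: "fps_conv_radius A \<ge> 1" and t: "t > 0"
    and lim: "(\<lambda>n. fps_nth A n * real n powr (1 - t)) \<longlonglongrightarrow> L"
  shows "((\<lambda>r. eval_fps A r * (1 - r) powr t) \<longlongrightarrow> L * Gamma t) (at_left 1)"
proof -
  have tn: "t \<notin> \<int>\<^sub>\<le>\<^sub>0" using t by (auto elim!: nonpos_Ints_cases)
  have ev: "eventually (\<lambda>r::real. r \<in> {0<..<1}) (at_left 1)"
    by (rule eventually_at_left_real) simp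
  have "((\<lambda>r. eval_fps A r / eval_fps (binom_fps t) r) \<longlongrightarrow> L / (1 / Gamma t)) (at_left 1)"
  proof (rule abelian_ratio[OF A binom_fps_conv_radius])
    show "eventually (\<lambda>n. fps_nth (binom_fps t) n > 0) sequentially"
      using t by (intro always_eventually) (simp add: pochhammer_pos)
    have "(\<lambda>n. (fps_nth A n * real n powr (1 - t)) / (pochhammer t n / fact n * real n powr (1 - t))) 
            \<longlonglongrightarrow> L / (1 / Gamma t)"
      using t tn by (intro tendsto_divide lim pochhammer_asymp) (auto simp: Gamma_eq_zero_iff)
    moreover have "eventually (\<lambda>n. (fps_nth A n * real n powr (1 - t)) / (pochhammer t n / fact n * real n powr (1 - t))
        = fps_nth A n / fps_nth (binom_fps t) n) sequentially"
      using eventually_gt_at_top[of 0] by eventually_elim auto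
    ultimately show "(\<lambda>n. fps_nth A n / fps_nth (binom_fps t) n) \<longlonglongrightarrow> L / (1 / Gamma t)"
      by (simp add: tendsto_cong)
    have "filterlim (\<lambda>r::real. (1 - r) powr (- t)) at_top (at_left 1)"
      unfolding powr_minus
    proof (rule filterlim_inverse_at_top)
      have "((\<lambda>r::real. 1 - r) \<longlongrightarrow> 1 - 1) (at_left 1)" by (intro tendsto_intros)
      moreover have "eventually (\<lambda>r::real. 0 \<le> 1 - r) (at_left 1)"
        using ev by eventually_elim simp
      ultimately show "((\<lambda>r::real. (1 - r) powr t) \<longlongrightarrow> 0) (at_left 1)"
        using t by (intro tendsto_zero_powrI[of _ _ _ t]) auto
      show "eventually (\<lambda>r::real. 0 < (1 - r) powr t) (at_left 1)"
        using ev by eventually_elim simp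
    qed
    moreover have "eventually (\<lambda>r. (1 - r) powr (- t) = eval_fps (binom_fps t) r) (at_left 1)"
      using ev by eventually_elim (simp add: eval_binom_fps)
    ultimately show "filterlim (eval_fps (binom_fps t)) at_top (at_left 1)"
      by (simp add: filterlim_cong[OF refl refl])
  qed
  moreover have "eventually (\<lambda>r. eval_fps A r / eval_fps (binom_fps t) r = eval_fps A r * (1 - r) powr t) (at_left 1)"
    using ev by eventually_elim (simp add: eval_binom_fps powr_minus field_simps)
  ultimately show ?thesis by (simp add: tendsto_cong)
qed

section \<open>The hypergeometric equation and Euler's transformation\<close>

text \<open>
  The differential operator \<open>x (1 - x) H'' + (c - (a + b + 1) x) H' - a b H\<close>, on formal power series so
  that membership in its kernel is a recursion for the coefficients.
\<close>

definition hypergeometric_operator :: "real \<Rightarrow> real \<Rightarrow> real \<Rightarrow> real fps \<Rightarrow> real fps" where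
  "hypergeometric_operator a b c H = fps_X * (1 - fps_X) * fps_deriv (fps_deriv H)
     + (fps_const c - fps_const (a + b + 1) * fps_X) * fps_deriv H - fps_const (a * b) * H"

lemma hypergeometric_operator_nth:
  "fps_nth (hypergeometric_operator a b c H) n =
     (c + real n) * (real n + 1) * fps_nth H (Suc n) - (a + real n) * (b + real n) * fps_nth H n"
proof (cases n)
  case 0
  thus ?thesis by (simp add: hypergeometric_operator_def algebra_simps)
next
  case (Suc m)
  have "fps_X * (1 - fps_X) * D = fps_X * D - fps_X * (fps_X * D)" for D :: "real fps"
    by (simp add: algebra_simps)
  moreover have "(fps_const c - fps_const (a + b + 1) * fps_X) * D = 
     fps_const c * D - fps_const (a + b + 1) * (fps_X * D)" for D :: "real fps"
    by (simp add: algebra_simps)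
  ultimately show ?thesis unfolding hypergeometric_operator_def Suc
    by (cases m) (simp_all add: algebra_simps)
qed

lemma Gauss_fps_ode:
  assumes "c \<notin> \<int>\<^sub>\<le>\<^sub>0"
  shows "hypergeometric_operator a b c (Gauss_fps a b c) = 0"
  by (rule fps_ext) (simp only: hypergeometric_operator_nth Gauss_fps_rec[OF assms] fps_zero_nth diff_self)

text \<open>
  The recursion can be solved for the next coefficient because \<open>c + n\<close> never vanishes.
\<close>

lemma hypergeometric_operator_kernel:
  assumes c: "c \<notin> \<int>\<^sub>\<le>\<^sub>0" and H: "hypergeometric_operator a b c H = 0" and H0: "fps_nth H 0 = 1"
  shows "H = Gauss_fps a b c"
proof (rule fps_ext)
  fix n
  show "fps_nth H n = fps_nth (Gauss_fps a b c) n"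
  proof (induction n)
    case 0 thus ?case using H0 by simp
  next
    case (Suc n)
    have "c + real n \<noteq> 0" 
      using c by (metis add_eq_0_iff minus_of_nat_in_nonpos_Ints add.commute)
    hence nz: "(c + real n) * (real n + 1) \<noteq> 0" by (auto simp: add_eq_0_iff)
    have "(c + real n) * (real n + 1) * fps_nth H (Suc n) = (a + real n) * (b + real n) * fps_nth H n"
      using hypergeometric_operator_nth[of a b c H n] H by simp
    also have "\<dots> = (c + real n) * (real n + 1) * fps_nth (Gauss_fps a b c) (Suc n)"
      unfolding Suc Gauss_fps_rec[OF c] ..
    finally show ?case using nz by (metis mult_left_cancel)
  qed
qed

lemma binom_fps_deriv: "(1 - fps_X) * fps_deriv (binom_fps s) = fps_const s * binom_fps s"
proof (rule fps_ext)
  fix n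
  have D: "fps_nth (fps_deriv (binom_fps s)) n = (s + real n) * fps_nth (binom_fps s) n" for n
  proof -
    have "real (Suc n) \<noteq> 0" by simp
    thus ?thesis by (simp add: pochhammer_Suc fact_Suc del: of_nat_Suc)
  qed
  have "(1 - fps_X) * fps_deriv (binom_fps s) = fps_deriv (binom_fps s) - fps_X * fps_deriv (binom_fps s)"
    by (simp add: left_diff_distrib)
  moreover have "fps_nth (fps_X * fps_deriv (binom_fps s)) n = real n * fps_nth (binom_fps s) n"
    by (cases n) simp_all
  ultimately have "fps_nth ((1 - fps_X) * fps_deriv (binom_fps s)) n =
      (s + real n) * fps_nth (binom_fps s) n - real n * fps_nth (binom_fps s) n"
    by (simp only: fps_sub_nth D)
  also have "\<dots> = s * fps_nth (binom_fps s) n" by (simp only: distrib_right add_diff_cancel_right')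
  finally show "fps_nth ((1 - fps_X) * fps_deriv (binom_fps s)) n = fps_nth (fps_const s * binom_fps s) n"
    by (simp only: fps_mult_left_const_nth)
qed

text \<open>
  The right-hand side has constant term \<open>1\<close> and solves the hypergeometric equation with parameters
  \<open>c - a, c - b; c\<close>, so it is the Gauss series with these parameters. The equation is verified in the
  ring of formal power series after multiplication by \<open>1 - x\<close>, which turns the first two derivatives of
  the binomial factor \<open>P\<close> into linear combinations of \<open>P\<close> and \<open>P'\<close>.
\<close>

lemma Euler_transformation:
  assumes c: "c \<notin> \<int>\<^sub>\<le>\<^sub>0"
  shows "Gauss_fps (c - a) (c - b) c = binom_fps (c - a - b) * Gauss_fps a b c"
proof -
  define s where "s = c - a - b"
  define P where "P = binom_fps s"
  define F where "F = Gauss_fps a b c"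
  define X where "X = (fps_X :: real fps)"
  define H where "H = P * F"
  define F1 F2 P1 P2 H1 H2 where "F1 = fps_deriv F" and "F2 = fps_deriv F1"
    and "P1 = fps_deriv P" and "P2 = fps_deriv P1"
    and "H1 = fps_deriv H" and "H2 = fps_deriv H1"
  define kc ka kb :: "real fps" where "kc = fps_const c" and "ka = fps_const a" and "kb = fps_const b"
  have P1: "(1 - X) * P1 = (kc - ka - kb) * P"
    using binom_fps_deriv[of s] by (simp add: P1_def P_def X_def s_def kc_def ka_def kb_def)
  have P2: "(1 - X) * P2 = (kc - ka - kb) * P1 + P1"
  proof -
    have "fps_deriv ((1 - X) * P1) = fps_deriv (fps_const s * P)"
      using binom_fps_deriv[of s] by (simp add: P1_def P_def X_def)
    hence "- P1 + (1 - X) * P2 = fps_const s * P1"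
      by (simp add: X_def P1_def P2_def)
    thus ?thesis by (simp add: s_def kc_def ka_def kb_def algebra_simps flip: fps_const_sub fps_const_add)
  qed
  have F: "X * (1 - X) * F2 + (kc - (ka + kb + 1) * X) * F1 - ka * kb * F = 0"
    using Gauss_fps_ode[OF c, of a b]
    by (simp add: hypergeometric_operator_def F_def F2_def F1_def X_def kc_def ka_def kb_def flip: fps_const_1_eq_1)
  have H1: "H1 = P1 * F + P * F1" unfolding H1_def H_def P1_def F1_def by simp
  have H2: "H2 = P2 * F + 2 * P1 * F1 + P * F2"
    unfolding H2_def H1 by (simp add: P1_def F1_def P2_def F2_def algebra_simps)
  define Z where "Z = X * (1 - X) * H2 + (kc - (2 * kc - ka - kb + 1) * X) * H1 - (kc - ka) * (kc - kb) * H"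
  have "(1 - X) * Z = 0"
    unfolding Z_def H1 H2 H_def using P1 P2 F by algebra
  moreover have "1 - X \<noteq> 0" unfolding X_def
    by (metis eq_iff_diff_eq_0 fps_X_neq_one)
  ultimately have "Z = 0" by simp
  hence "hypergeometric_operator (c - a) (c - b) c H = 0"
    unfolding Z_def hypergeometric_operator_def H1_def H2_def X_def kc_def ka_def kb_def
    by (simp add: algebra_simps flip: fps_const_add fps_const_sub fps_const_mult fps_const_1_eq_1)
  moreover have "fps_nth H 0 = 1" by (simp add: H_def P_def F_def)
  ultimately show ?thesis using hypergeometric_operator_kernel[OF c] by (metis H_def P_def F_def s_def)
qed

section \<open>The logarithmic derivative on the positive radius\<close>

text \<open>
  \<open>x (1 - x) G'\<close> contains \<open>F''\<close> only in the combination that the hypergeometric equation removes. In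
  what remains, \<open>F'\<close> can be absorbed into \<open>x F' = G - F\<close>: once the term \<open>(1 - s) G\<close> has been split
  off, the coefficient of \<open>F'\<close> is \<open>(1 - a - b) x (1 - x)\<close>. Division by \<open>(1 - x) G\<close> yields the
  expansion of \<open>x G' / G\<close> at \<open>1\<close>.
\<close>

lemma Gauss_fps_convexity_identity:
  fixes a b c :: real
  defines "F \<equiv> Gauss_fps a b c"
  defines "G \<equiv> fps_deriv (fps_X * F)"
  assumes c: "c \<notin> \<int>\<^sub>\<le>\<^sub>0"
  shows "fps_X * ((1 - fps_X) * fps_deriv G) =
     fps_const (1 - (c - a - b)) * G + fps_const (1 - a - b) * ((1 - fps_X) * G)
     + F * (fps_const (a * b) * fps_X - fps_const (1 - (c - a - b)) - fps_const (1 - a - b) * (1 - fps_X))"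
proof -
  define X where "X = (fps_X :: real fps)"
  define kc ka kb :: "real fps" where "kc = fps_const c" and "ka = fps_const a" and "kb = fps_const b"
  define F1 F2 where "F1 = fps_deriv F" and "F2 = fps_deriv F1"
  have F: "X * (1 - X) * F2 + (kc - (ka + kb + 1) * X) * F1 - ka * kb * F = 0"
    using Gauss_fps_ode[OF c, of a b]
    by (simp add: hypergeometric_operator_def F_def F2_def F1_def X_def kc_def ka_def kb_def flip: fps_const_1_eq_1)
  have G: "G = F + X * F1" by (simp add: G_def X_def F1_def)
  have G1: "fps_deriv G = 2 * F1 + X * F2"
    unfolding G by (simp add: X_def F1_def F2_def algebra_simps)
  have k: "fps_const (1 - (c - a - b)) = 1 - (kc - ka - kb)" "fps_const (1 - a - b) = 1 - ka - kb"
    "fps_const (a * b) = ka * kb"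
    by (simp_all add: kc_def ka_def kb_def flip: fps_const_1_eq_1)
  show ?thesis unfolding k G1 unfolding X_def[symmetric] G using F by algebra
qed

text \<open>
  For \<open>c \<le> a + b\<close>, the coefficients are eventually of one sign, that of the Gamma quotient \<open>K\<close>, and at
  least a positive multiple of \<open>1 / n\<close> in modulus. So the series tends to plus or minus infinity, and positivity
  of the function decides which.
\<close>

lemma Gauss_fps_at_top:
  fixes a b c :: real
  assumes "a \<notin> \<int>\<^sub>\<le>\<^sub>0" "b \<notin> \<int>\<^sub>\<le>\<^sub>0" "c \<notin> \<int>\<^sub>\<le>\<^sub>0" and s: "c \<le> a + b"
    and pos: "\<And>r. 0 \<le> r \<Longrightarrow> r < 1 \<Longrightarrow> eval_fps (Gauss_fps a b c) r > 0"
  shows "filterlim (eval_fps (Gauss_fps a b c)) at_top (at_left 1)"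
proof -
  define E where "E = Gauss_fps a b c"
  define K where "K = Gamma c / (Gamma a * Gamma b)"
  have "K \<noteq> 0" using assms by (simp add: K_def Gamma_eq_zero_iff)
  define B where "B = fps_const (sgn K) * E"
  have E: "fps_conv_radius E \<ge> 1" using Gauss_fps_conv_radius[of c a b] assms by (simp add: E_def)
  have B: "fps_conv_radius B \<ge> 1" unfolding B_def by (rule fps_conv_radius_unit) (use E in simp_all)
  have "(\<lambda>n. sgn K * (fps_nth E n * real n powr (1 + c - a - b))) \<longlonglongrightarrow> sgn K * K"
    unfolding E_def K_def by (intro tendsto_mult tendsto_const Gauss_fps_asymp assms)
  hence "(\<lambda>n. sgn K * (fps_nth E n * real n powr (1 + c - a - b))) \<longlonglongrightarrow> \<bar>K\<bar>"
    by (simp add: mult_sgn_abs abs_sgn mult.commute)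
  hence "eventually (\<lambda>n. sgn K * (fps_nth E n * real n powr (1 + c - a - b)) > \<bar>K\<bar> / 2) sequentially"
    by (rule order_tendstoD) (use \<open>K \<noteq> 0\<close> in simp)
  hence ev: "eventually (\<lambda>n. \<bar>K\<bar> / 2 * inverse (real n) \<le> fps_nth B n) sequentially"
    using eventually_gt_at_top[of 0]
  proof eventually_elim
    case (elim n)
    have "real n powr (1 + c - a - b) \<le> real n powr 1" using elim s by (intro powr_mono) auto
    hence le: "real n powr (1 + c - a - b) \<le> real n" using elim by simp
    have gt: "fps_nth B n * real n powr (1 + c - a - b) > \<bar>K\<bar> / 2"
      using elim by (simp add: B_def mult.assoc del: fps_hypergeo_nth)
    hence "0 < fps_nth B n * real n powr (1 + c - a - b)" using abs_ge_zero[of K] by linarith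
    hence "fps_nth B n \<ge> 0" using elim by (simp add: zero_less_mult_iff)
    hence "fps_nth B n * real n powr (1 + c - a - b) \<le> fps_nth B n * real n"
      using le by (intro mult_left_mono)
    hence "\<bar>K\<bar> / 2 \<le> fps_nth B n * real n" using gt by linarith
    thus ?case using elim by (simp add: field_simps)
  qed
  have "filterlim (eval_fps B) at_top (at_left 1)"
  proof (rule eval_fps_at_top[OF B])
    show "eventually (\<lambda>n. fps_nth B n \<ge> 0) sequentially"
      using ev
    proof eventually_elim
      case (elim n)
      have "0 \<le> \<bar>K\<bar> / 2 * inverse (real n)" by simp
      thus ?case using elim by (rule order_trans)
    qed
    show "\<not> summable (fps_nth B)"
    proof
      assume "summable (fps_nth B)"
      hence "summable (\<lambda>n. \<bar>K\<bar> / 2 * inverse (real n))"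
        by (rule summable_comparison_test_ev[rotated]) (use ev in \<open>auto elim!: eventually_mono\<close>)
      hence "summable (\<lambda>n. inverse (real n))" using \<open>K \<noteq> 0\<close> by (simp add: summable_cmult_iff)
      thus False using not_summable_harmonic[where 'a = real] by simp
    qed
  qed
  moreover have ev1: "eventually (\<lambda>r::real. r \<in> {0<..<1}) (at_left 1)"
    by (rule eventually_at_left_real) simp
  moreover have "eventually (\<lambda>r. eval_fps B r = sgn K * eval_fps E r) (at_left 1)"
    using ev1 by eventually_elim (simp add: B_def eval_fps_mult_unit E)
  ultimately have lim: "filterlim (\<lambda>r. sgn K * eval_fps E r) at_top (at_left 1)"
    by (simp add: filterlim_cong[OF refl refl])
  have "K > 0"
  proof (rule ccontr)
    assume "\<not> K > 0"
    have "eventually (\<lambda>r. sgn K * eval_fps E r \<ge> 1) (at_left 1)"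
      using lim unfolding filterlim_at_top by blast
    hence "eventually (\<lambda>r. False) (at_left (1::real))"
      using ev1
    proof eventually_elim
      case (elim r)
      have "sgn K * eval_fps E r \<le> 0" using pos[of r] elim \<open>\<not> K > 0\<close> 
        by (intro mult_nonpos_nonneg) (auto simp: E_def sgn_if)
      thus ?case using elim by simp
    qed
    thus False by simp
  qed
  thus ?thesis using lim by (simp add: E_def)
qed

text \<open>
  The expansion of \<open>p\<close> at \<open>1\<close> to second order. The coefficients of \<open>G\<close> and \<open>F\<close> are asymptotic to
  \<open>K n powr (- s)\<close> and \<open>K n powr (- 1 - s)\<close>. Hence \<open>G\<close> has exact order \<open>(1 - r) powr (s - 1)\<close> while \<open>F\<close>
  is of smaller order, which makes the third term of the identity for \<open>p\<close> negligible against
  \<open>1 / (1 - r)\<close>. That term still tends to minus infinity.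
\<close>

lemma convexity_radial_asymptotics:
  fixes a b c :: real
  defines "s \<equiv> c - a - b"
  defines "F \<equiv> Gauss_fps a b c"
  defines "G \<equiv> fps_deriv (fps_X * F)"
  defines "p \<equiv> (\<lambda>r. r * eval_fps (fps_deriv G) r / eval_fps G r)"
  assumes nonpos: "a \<notin> \<int>\<^sub>\<le>\<^sub>0" "b \<notin> \<int>\<^sub>\<le>\<^sub>0" "c \<notin> \<int>\<^sub>\<le>\<^sub>0" "c - a \<notin> \<int>\<^sub>\<le>\<^sub>0" "c - b \<notin> \<int>\<^sub>\<le>\<^sub>0"
    and s: "0 \<le> s" "s < 1" "s < 1 - a * b"
    and Gpos: "\<And>r. 0 \<le> r \<Longrightarrow> r < 1 \<Longrightarrow> eval_fps G r > 0"
  shows "((\<lambda>r. (1 - r) * p r) \<longlongrightarrow> 1 - s) (at_left 1)"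
    and "filterlim (\<lambda>r. (1 - s) / (1 - r) - p r) at_top (at_left 1)"
proof -
  have ev1: "eventually (\<lambda>r::real. r \<in> {0<..<1}) (at_left 1)"
    by (rule eventually_at_left_real) simp
  define E where "E = Gauss_fps (c - a) (c - b) c"
  have rF: "fps_conv_radius F \<ge> 1" using Gauss_fps_conv_radius[of c a b] nonpos by (simp add: F_def)
  have rXF: "fps_conv_radius (fps_X * F) \<ge> 1" by (rule fps_conv_radius_unit) (use rF in simp_all)
  have rG: "fps_conv_radius G \<ge> 1" unfolding G_def by (rule fps_conv_radius_deriv_unit[OF rXF])
  have rG': "fps_conv_radius (fps_deriv G) \<ge> 1" by (rule fps_conv_radius_deriv_unit[OF rG])
  have Fpos: "eval_fps F r > 0" if r: "0 \<le> r" "r < 1" for r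
  proof (cases "r = 0")
    case True thus ?thesis by (simp add: eval_fps_at_0 F_def)
  next
    case False
    have "\<exists>z. 0 < z \<and> z < r \<and> eval_fps (fps_X * F) r - eval_fps (fps_X * F) 0 = (r - 0) * eval_fps G z"
    proof (rule MVT2)
      show "0 < r" using False r by simp
      fix x assume x: "0 \<le> x" "x \<le> r"
      have "ereal (norm x) < 1" using x r by simp
      hence "ereal (norm x) < fps_conv_radius (fps_X * F)" using rXF by (rule less_le_trans)
      thus "(eval_fps (fps_X * F) has_real_derivative eval_fps G x) (at x)"
        unfolding G_def by (rule has_field_derivative_eval_fps)
    qed
    then obtain z where "0 < z" "z < r" "eval_fps (fps_X * F) r = r * eval_fps G z"
      by (auto simp: eval_fps_at_0)
    moreover have "eval_fps (fps_X * F) r = r * eval_fps F r" using r by (simp add: eval_fps_mult_unit rF)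
    ultimately have "eval_fps F r = eval_fps G z" using False by simp
    thus ?thesis using Gpos[of z] \<open>0 < z\<close> \<open>z < r\<close> r by simp
  qed
  define K where "K = Gamma c / (Gamma a * Gamma b)"
  define \<kappa> where "\<kappa> = K * Gamma (1 - s)"
  have K: "(\<lambda>n. fps_nth F n * real n powr (1 + s)) \<longlonglongrightarrow> K"
    using Gauss_fps_asymp[of a b c] nonpos by (simp add: F_def K_def s_def algebra_simps)
  have limG: "((\<lambda>r. eval_fps G r * (1 - r) powr (1 - s)) \<longlongrightarrow> \<kappa>) (at_left 1)"
    unfolding \<kappa>_def
  proof (rule abelian_power[OF rG])
    have "(\<lambda>n. real (Suc n) / real n * (fps_nth F n * real n powr (1 + s))) \<longlonglongrightarrow> 1 * K"
      by (intro tendsto_mult K LIMSEQ_Suc_n_over_n)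
    moreover have "eventually (\<lambda>n. real (Suc n) / real n * (fps_nth F n * real n powr (1 + s)) =
        fps_nth G n * real n powr (1 - (1 - s))) sequentially"
      using eventually_gt_at_top[of 0]
    proof eventually_elim
      case (elim n)
      have "real n powr (1 + s) = real n * real n powr s" using elim by (simp add: powr_add)
      thus ?case using elim by (simp add: G_def field_simps del: fps_hypergeo_nth)
    qed
    ultimately show "(\<lambda>n. fps_nth G n * real n powr (1 - (1 - s))) \<longlonglongrightarrow> K" by (simp add: tendsto_cong)
  qed (use s in simp)
  have limF: "((\<lambda>r. eval_fps F r * (1 - r) powr (1 - s)) \<longlongrightarrow> 0 * Gamma (1 - s)) (at_left 1)"
  proof (rule abelian_power[OF rF])
    have "(\<lambda>n. 1 / real n * (fps_nth F n * real n powr (1 + s))) \<longlonglongrightarrow> 0 * K"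
      by (intro tendsto_mult K lim_1_over_n)
    moreover have "eventually (\<lambda>n. 1 / real n * (fps_nth F n * real n powr (1 + s)) =
        fps_nth F n * real n powr (1 - (1 - s))) sequentially"
      using eventually_gt_at_top[of 0]
    proof eventually_elim
      case (elim n)
      have "real n powr (1 + s) = real n * real n powr s" using elim by (simp add: powr_add)
      thus ?case using elim by (simp del: fps_hypergeo_nth)
    qed
    ultimately show "(\<lambda>n. fps_nth F n * real n powr (1 - (1 - s))) \<longlonglongrightarrow> 0" by (simp add: tendsto_cong)
  qed (use s in simp)
  have "\<kappa> \<noteq> 0" using nonpos s by (auto simp: \<kappa>_def K_def Gamma_eq_zero_iff elim!: nonpos_Ints_cases)
  moreover have "\<kappa> \<ge> 0"
    by (rule tendsto_lowerbound[OF limG])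
       (use ev1 in \<open>auto elim!: eventually_mono intro!: mult_nonneg_nonneg less_imp_le[OF Gpos]\<close>)
  ultimately have "\<kappa> > 0" by simp
  have FG: "((\<lambda>r. eval_fps F r / eval_fps G r) \<longlongrightarrow> 0) (at_left 1)"
  proof -
    have "((\<lambda>r. (eval_fps F r * (1 - r) powr (1 - s)) / (eval_fps G r * (1 - r) powr (1 - s))) \<longlongrightarrow> 0 * Gamma (1 - s) / \<kappa>) (at_left 1)"
      using \<open>\<kappa> > 0\<close> by (intro tendsto_divide limF limG) simp
    moreover have "eventually (\<lambda>r. (eval_fps F r * (1 - r) powr (1 - s)) / (eval_fps G r * (1 - r) powr (1 - s))
       = eval_fps F r / eval_fps G r) (at_left 1)"
      using ev1 by eventually_elim auto
    ultimately show ?thesis by (simp add: tendsto_cong)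
  qed
  have rE: "fps_conv_radius E \<ge> 1" using Gauss_fps_conv_radius[of c "c - a" "c - b"] nonpos by (simp add: E_def)
  have EF: "eval_fps E r = (1 - r) powr (- s) * eval_fps F r" if "0 \<le> r" "r < 1" for r
    using that unfolding E_def Euler_transformation[OF nonpos(3)] 
    by (simp add: eval_fps_mult_unit binom_fps_conv_radius rF[unfolded F_def] F_def s_def eval_binom_fps)
  have Etop: "filterlim (eval_fps E) at_top (at_left 1)"
    unfolding E_def
  proof (rule Gauss_fps_at_top)
    show "eval_fps (Gauss_fps (c - a) (c - b) c) r > 0" if "0 \<le> r" "r < 1" for r
      using EF[OF that] Fpos[OF that] that by (simp add: E_def)
  qed (use nonpos s in \<open>auto simp: s_def\<close>)
  \<comment> \<open>By Euler's transformation, \<open>W\<close> equals \<open>E\<close> divided by a factor that tends to \<open>\<kappa>\<close>.\<close>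
  define W where "W r = eval_fps F r / ((1 - r) * eval_fps G r)" for r
  have W: "filterlim W at_top (at_left 1)"
  proof -
    have "filterlim (\<lambda>r. inverse (eval_fps G r * (1 - r) powr (1 - s)) * eval_fps E r) at_top (at_left 1)"
      by (rule filterlim_tendsto_pos_mult_at_top[OF tendsto_inverse[OF limG] _ Etop]) (use \<open>\<kappa> > 0\<close> in auto)
    moreover have "eventually (\<lambda>r. inverse (eval_fps G r * (1 - r) powr (1 - s)) * eval_fps E r = W r) (at_left 1)"
      using ev1
    proof eventually_elim
      case (elim r)
      have "(1 - r) powr (1 - s) = (1 - r) * (1 - r) powr (- s)"
        using elim powr_add[of "1 - r" 1 "- s"] by simp
      thus ?case using elim Gpos[of r] by (simp only: W_def) (simp add: EF divide_inverse)
    qed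
    ultimately show ?thesis by (simp add: filterlim_cong[OF refl refl])
  qed
  \<comment> \<open>The limit \<open>a b - (1 - s)\<close> of \<open>\<phi>\<close> at \<open>1\<close> is negative: this is the hypothesis \<open>s < 1 - a b\<close>.\<close>
  define \<phi> where "\<phi> r = a * b * r - (1 - s) - (1 - a - b) * (1 - r)" for r
  have \<phi>: "(\<phi> \<longlongrightarrow> a * b * 1 - (1 - s) - (1 - a - b) * (1 - 1)) (at_left 1)"
    unfolding \<phi>_def[abs_def] by (intro tendsto_intros)
  have id: "p r = (1 - s) / (1 - r) + (1 - a - b) + \<phi> r * W r" if r: "0 \<le> r" "r < 1" for r
  proof -
    have r1: "fps_conv_radius (1 - fps_X :: real fps) \<ge> 1" by (rule fps_conv_radius_unit) simp_all
    have "eval_fps (fps_X * ((1 - fps_X) * fps_deriv G)) r = eval_fps (fps_const (1 - (c - a - b)) * G + fps_const (1 - a - b) * ((1 - fps_X) * G)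
     + F * (fps_const (a * b) * fps_X - fps_const (1 - (c - a - b)) - fps_const (1 - a - b) * (1 - fps_X))) r"
      unfolding F_def G_def by (subst Gauss_fps_convexity_identity[OF nonpos(3)]) (rule refl)
    hence "r * ((1 - r) * eval_fps (fps_deriv G) r) = (1 - s) * eval_fps G r + (1 - a - b) * ((1 - r) * eval_fps G r)
        + eval_fps F r * \<phi> r"
      using r by (simp add: eval_fps_mult_unit eval_fps_add_unit eval_fps_diff_unit fps_conv_radius_unit r1 rF rG rG' \<phi>_def s_def
          del: fps_const_mult fps_const_sub fps_const_add)
    moreover have "eval_fps G r > 0" using Gpos[OF r] .
    moreover from this have "W r * ((1 - r) * eval_fps G r) = eval_fps F r" using r by (simp add: W_def)
    moreover have "(1 - s) / (1 - r) * (1 - r) = 1 - s" using r by simp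
    ultimately have "(r * eval_fps (fps_deriv G) r) * (1 - r) =
       (eval_fps G r * ((1 - s) / (1 - r) + (1 - a - b) + \<phi> r * W r)) * (1 - r)"
      by algebra
    hence "r * eval_fps (fps_deriv G) r = 
       eval_fps G r * ((1 - s) / (1 - r) + (1 - a - b) + \<phi> r * W r)"
      using r by simp
    thus ?thesis unfolding p_def using Gpos[OF r] by simp
  qed
  show "((\<lambda>r. (1 - r) * p r) \<longlongrightarrow> 1 - s) (at_left 1)"
  proof -
    have "((\<lambda>r. (1 - s) + (1 - a - b) * (1 - r) + \<phi> r * (eval_fps F r / eval_fps G r)) \<longlongrightarrow>
      (1 - s) + (1 - a - b) * (1 - 1) + (a * b * 1 - (1 - s) - (1 - a - b) * (1 - 1)) * 0) (at_left 1)"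
      by (intro tendsto_intros \<phi> FG)
    moreover have "eventually (\<lambda>r. (1 - s) + (1 - a - b) * (1 - r) + \<phi> r * (eval_fps F r / eval_fps G r) = (1 - r) * p r) (at_left 1)"
      using ev1
    proof eventually_elim
      case (elim r)
      have id': "p r = (1 - s) / (1 - r) + (1 - a - b) + \<phi> r * W r" using id[of r] elim by auto
      have "(1 - r) * W r = eval_fps F r / eval_fps G r" using elim by (simp add: W_def)
      moreover have "(1 - r) * ((1 - s) / (1 - r)) = 1 - s" using elim by simp
      moreover have "(1 - r) * p r = (1 - r) * ((1 - s) / (1 - r)) + (1 - a - b) * (1 - r) + \<phi> r * ((1 - r) * W r)"
        unfolding id' by (simp only: distrib_left mult_ac)
      ultimately show ?case by simp
    qed
    ultimately show ?thesis by (simp add: tendsto_cong)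
  qed
  show "filterlim (\<lambda>r. (1 - s) / (1 - r) - p r) at_top (at_left 1)"
  proof -
    have "filterlim (\<lambda>r. (a + b - 1) + (- \<phi> r) * W r) at_top (at_left 1)"
      by (intro filterlim_tendsto_add_at_top[OF tendsto_const]
           filterlim_tendsto_pos_mult_at_top[OF tendsto_minus[OF \<phi>] _ W]) (use s in simp)
    moreover have "eventually (\<lambda>r. (a + b - 1) + (- \<phi> r) * W r = (1 - s) / (1 - r) - p r) (at_left 1)"
      using ev1 by eventually_elim (simp add: id)
    ultimately show ?thesis by (simp add: filterlim_cong[OF refl refl])
  qed
qed

section \<open>The order of convexity\<close>

lemma eval_fps_of_real:
  fixes B :: "real fps" and A :: "'a :: {banach, real_normed_field} fps"
  assumes "\<And>n. fps_nth A n = of_real (fps_nth B n)" and "fps_conv_radius B \<ge> 1" "0 \<le> r" "r < 1"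
  shows "eval_fps A (of_real r) = of_real (eval_fps B r)"
  unfolding eval_fps_def using suminf_of_real[OF summable_fps_real[OF assms(2-4)], where ?'a = 'a]
  by (simp add: assms(1))

theorem theorem1p1:
  fixes a b c :: real and f :: "complex \<Rightarrow> complex"
  assumes "a \<notin> {x \<in> \<int>. x < 0}" and "b \<notin> {x \<in> \<int>. x < 0}" and "c \<notin> {x \<in> \<int>. x < 0}"
    and "c \<noteq> 0"
    and "c - a \<notin> \<int>\<^sub>\<le>\<^sub>0" and "c - b \<notin> \<int>\<^sub>\<le>\<^sub>0"
    and "(0 < a * b \<and> a * b < 1 \<and> a + b \<le> c \<and> c < 1 + a + b - a * b) \<or>
         (a * b < 0 \<and> a + b \<le> c \<and> c < 1 + a + b)"
    and f_def: "f = (\<lambda>z. z * hyp2F1 a b c z)"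
    and kappa_defined: "order_of_convexity f \<noteq> None"
  shows "order_of_convexity f = Some (- \<infinity>)"
proof -
  have "x \<notin> \<int>\<^sub>\<le>\<^sub>0" if "x \<notin> {x \<in> \<int>. x < 0}" "x \<noteq> 0" for x :: real
    using that by (auto simp: nonpos_Ints_def)
  moreover have "a \<noteq> 0" "b \<noteq> 0" using assms(7) by auto
  ultimately have nonpos: "a \<notin> \<int>\<^sub>\<le>\<^sub>0" "b \<notin> \<int>\<^sub>\<le>\<^sub>0" "c \<notin> \<int>\<^sub>\<le>\<^sub>0" using assms(1-4) by blast+
  define s where "s = c - a - b"
  have s: "0 \<le> s" "s < 1" "s < 1 - a * b" using assms(7) by (auto simp: s_def)
  define F where "F = Gauss_fps a b c"
  define G where "G = fps_deriv (fps_X * F)"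
  define Fc where "Fc = Gauss_fps (complex_of_real a) (complex_of_real b) (complex_of_real c)"
  define Gc where "Gc = fps_deriv (fps_X * Fc)"
  have nc: "complex_of_real x \<notin> \<int>\<^sub>\<le>\<^sub>0" if "x \<notin> \<int>\<^sub>\<le>\<^sub>0" for x
    using that by (simp add: of_real_in_nonpos_Ints_iff)
  have rF: "fps_conv_radius F \<ge> 1" using Gauss_fps_conv_radius[of c a b] nonpos by (simp add: F_def)
  have rXF: "fps_conv_radius (fps_X * F) \<ge> 1" by (rule fps_conv_radius_unit) (use rF in simp_all)
  have rG: "fps_conv_radius G \<ge> 1" unfolding G_def by (rule fps_conv_radius_deriv_unit[OF rXF])
  have rG': "fps_conv_radius (fps_deriv G) \<ge> 1" by (rule fps_conv_radius_deriv_unit[OF rG])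
  have rFc: "fps_conv_radius Fc \<ge> 1"
    using Gauss_fps_conv_radius[OF nc[OF nonpos(3)] nc[OF nonpos(1)] nc[OF nonpos(2)]] by (simp add: Fc_def)
  have rXFc: "fps_conv_radius (fps_X * Fc) \<ge> 1" by (rule fps_conv_radius_unit) (use rFc in simp_all)
  have rGc: "fps_conv_radius Gc \<ge> 1" unfolding Gc_def by (rule fps_conv_radius_deriv_unit[OF rXFc])
  have rGc': "fps_conv_radius (fps_deriv Gc) \<ge> 1" by (rule fps_conv_radius_deriv_unit[OF rGc])

  have deriv_eval: "deriv g z = eval_fps (fps_deriv A) z"
    if "\<And>w. norm w < 1 \<Longrightarrow> g w = eval_fps A w" "fps_conv_radius A \<ge> 1" "norm z < 1"
    for g :: "complex \<Rightarrow> complex" and A z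
  proof -
    have "eventually (\<lambda>w. w \<in> ball 0 1) (nhds z)" using that(3) by (intro eventually_nhds_in_open) auto
    hence "deriv g z = deriv (eval_fps A) z"
      by (intro deriv_cong_ev refl) (auto elim!: eventually_mono simp: that(1))
    also have "\<dots> = eval_fps (fps_deriv A) z"
      by (rule DERIV_imp_deriv, rule has_field_derivative_eval_fps, rule less_le_trans[OF _ that(2)])
         (use that(3) in simp)
    finally show ?thesis .
  qed
  have f: "f z = eval_fps (fps_X * Fc) z" if "norm z < 1" for z
    using that rFc by (simp add: f_def hyp2F1_def Fc_def eval_fps_mult_unit)
  have f1: "deriv f z = eval_fps Gc z" if "norm z < 1" for z
    unfolding Gc_def by (rule deriv_eval[OF f rXFc that])
  have f2: "deriv (deriv f) z = eval_fps (fps_deriv Gc) z" if "norm z < 1" for z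
    by (rule deriv_eval[OF f1 rGc that])

  have nzc: "eval_fps Gc z \<noteq> 0" if "norm z < 1" for z
    using kappa_defined f1[OF that] that by (auto simp: order_of_convexity_def split: if_splits)

  have FcF: "fps_nth Fc n = of_real (fps_nth F n)" for n
    by (simp add: Fc_def F_def flip: pochhammer_of_real)
  have GcG: "fps_nth Gc n = of_real (fps_nth G n)" for n by (simp add: Gc_def G_def FcF)
  have GcG': "fps_nth (fps_deriv Gc) n = of_real (fps_nth (fps_deriv G) n)" for n by (simp add: GcG)
  note realG = eval_fps_of_real[OF GcG rG] and realG' = eval_fps_of_real[OF GcG' rG']

  \<comment> \<open>Absence of zeros in the disc and \<open>G(0) = 1\<close> fix the sign of \<open>G\<close> on the radius.\<close>
  have Gpos: "eval_fps G r > 0" if r: "0 \<le> r" "r < 1" for r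
  proof (rule ccontr)
    assume "\<not> ?thesis"
    moreover have "eval_fps G 0 = 1" by (simp add: eval_fps_at_0 G_def F_def)
    moreover have "continuous_on {0..r} (eval_fps G)"
    proof (rule continuous_on_subset[OF continuous_on_eval_fps])
      have "ereal (norm x) < fps_conv_radius G" if "x \<in> {0..r}" for x
        by (rule less_le_trans[OF _ rG]) (use that r in simp)
      thus "{0..r} \<subseteq> eball 0 (fps_conv_radius G)" by auto
    qed
    ultimately obtain x where x: "0 \<le> x" "x \<le> r" "eval_fps G x = 0"
      using IVT2'[of "eval_fps G" r 0 0] r by auto
    thus False using nzc[of "of_real x"] realG[of x] r by simp
  qed

  define P where "P z = z * eval_fps (fps_deriv Gc) z / eval_fps Gc z" for z
  define p where "p r = r * eval_fps (fps_deriv G) r / eval_fps G r" for r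
  have Pp: "P (of_real r) = of_real (p r)" if "0 \<le> r" "r < 1" for r
    unfolding P_def p_def using realG[OF that] realG'[OF that] by simp
  have hol: "P holomorphic_on ball 0 1"
  proof -
    have "ball 0 1 \<subseteq> eball 0 (fps_conv_radius A)" if "fps_conv_radius A \<ge> 1" for A :: "complex fps"
      using ball_eball_mono[of 1 "fps_conv_radius A" 0] that by (simp add: one_ereal_def)
    thus ?thesis unfolding P_def[abs_def] using nzc rGc rGc'
      by (intro holomorphic_intros) auto
  qed
  note radial = convexity_radial_asymptotics
    [OF nonpos assms(5,6), folded F_def, folded G_def, folded s_def, folded p_def]
  have asymp1: "((\<lambda>r. (1 - r) * p r) \<longlongrightarrow> 1 - s) (at_left 1)"
    by (rule radial(1)[OF s]) (rule Gpos)
  have asymp2: "filterlim (\<lambda>r. (1 - s) / (1 - r) - p r) at_top (at_left 1)"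
    by (rule radial(2)[OF s]) (rule Gpos)

  have "(INF z\<in>ball 0 1. ereal (Re (P z))) = - \<infinity>"
  proof (rule ccontr)
    define I where "I = (INF z\<in>ball 0 1. ereal (Re (P z)))"
    assume "I \<noteq> - \<infinity>"
    then obtain M where M: "ereal (- M) \<le> I"
      by (cases I) (metis add.inverse_inverse order_refl, auto)
    have bound: "Re (P z) \<ge> - M" if "norm z < 1" for z
    proof -
      have "I \<le> ereal (Re (P z))" unfolding I_def by (rule INF_lower) (use that in simp)
      with M have "ereal (- M) \<le> ereal (Re (P z))" by (rule order_trans)
      thus ?thesis by simp
    qed
    note low = radial_lower_bound[OF hol bound Pp asymp1]
    have "eventually (\<lambda>r. (1 - s) / (1 - r) - p r \<ge> (1 - s) / 2 + M + 2) (at_left 1)"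
      using asymp2 unfolding filterlim_at_top by blast
    moreover have "eventually (\<lambda>r::real. r \<in> {0<..<1}) (at_left 1)"
      by (rule eventually_at_left_real) simp
    ultimately have "eventually (\<lambda>r. False) (at_left (1::real))"
    proof eventually_elim
      case (elim r)
      thus ?case using low[of r] by auto
    qed
    thus False by simp
  qed
  moreover have "(INF z\<in>ball 0 1. ereal (Re (z * deriv (deriv f) z / deriv f z))) = (INF z\<in>ball 0 1. ereal (Re (P z)))"
    by (intro INF_cong refl) (simp add: P_def f1 f2)
  ultimately show ?thesis using kappa_defined
    by (auto simp: order_of_convexity_def split: if_splits)
qed

end
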